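(* Let $p>1$ and $q\in[1,\infty]$, let $p_1,p_2\in[1,\infty)$ and $q_1,q_2\in(0,\infty]$ satisfy \[ \frac{1}{p_1}+\frac{1}{p_2}=\frac{1}{p},\qquad \frac{1}{q_1}+\frac{1}{q_2}\geq \frac{1}{q}, \] and let $f,g$ be measurable functions on $\mathbb{R}^N$ with $|||f|||_{L^{p_1,q_1}(\mathbb{R}^N)}<\infty$ and $|||g|||_{L^{p_2,q_2}(\mathbb{R}^N)}<\infty$. Then \[ \|fg\|_{L^{p,q}(\mathbb{R}^N)} \leq e^{1/e}\, p'\, |||f |||_{L^{p_1,q_1}(\mathbb{R}^N)}\,|||g |||_{L^{p_2,q_2}(\mathbb{R}^N)}, \] where $p'=p/(p-1)$.
   Context: For a measurable $f$ on $\mathbb{R}^N$ let $f^*$ be its non-increasing rearrangement (the left-continuous inverse of $y\mapsto|\{|f|>y\}|$) and $f^{**}(x)=\frac1x\int_0^x f^*(t)\,dt$. Norm: for $1<p<\infty$, $1\le q<\infty$, $\|f\|_{L^{p,q}(\mathbb{R}^N)} = (\int_0^\infty [t^{1/p}f^{**}(t)]^q\,\frac{dt}{t})^{1/q}$ and $\|f\|_{L^{p,\infty}(\mathbb{R}^N)}=\sup_{t>0}t^{1/p}f^{**}(t)$. Quasi-norm: for $1\le p<\infty$, $0<q<\infty$, $|||f|||_{L^{p,q}(\mathbb{R}^N)} = (\int_0^\infty (t^{1/p}f^{*}(t))^q\,\frac{dt}{t})^{1/q}$ and $|||f|||_{L^{p,\infty}(\mathbb{R}^N)}=\sup_{t>0}t^{1/p}f^{*}(t)$.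 *)

theory Defs
  imports "HOL-Analysis.Analysis"
begin

text \<open>Real power on ennreal (used only with positive exponents).\<close>
definition enn_powr :: "ennreal \<Rightarrow> real \<Rightarrow> ennreal" where
  "enn_powr x a = (if x = \<infinity> then \<infinity> else ennreal (enn2real x powr a))"

definition distrib_fun :: "('a::euclidean_space \<Rightarrow> real) \<Rightarrow> real \<Rightarrow> ennreal" where
  "distrib_fun f y = emeasure lebesgue {x. y < \<bar>f x\<bar>}"

text \<open>Non-increasing rearrangement: left-continuous inverse of the distribution function,
  f*(t) = inf {y \<ge> 0. distrib f y < t} (value \<infinity> if the set is empty).\<close>
definition rearr :: "('a::euclidean_space \<Rightarrow> real) \<Rightarrow> real \<Rightarrow> ennreal" where
  "rearr f t = Inf (ennreal ` {y::real. 0 \<le> y \<and> distrib_fun f y < ennreal t})"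

definition maxrearr :: "('a::euclidean_space \<Rightarrow> real) \<Rightarrow> real \<Rightarrow> ennreal" where
  "maxrearr f t = ennreal (1 / t) * (\<integral>\<^sup>+ s. rearr f s * indicator {0<..t} s \<partial>lborel)"

definition lorentz_norm :: "real \<Rightarrow> ennreal \<Rightarrow> ('a::euclidean_space \<Rightarrow> real) \<Rightarrow> ennreal" where
  "lorentz_norm p q f =
    (if q = \<infinity> then (SUP t\<in>{0<..}. ennreal (t powr (1/p)) * maxrearr f t)
     else enn_powr (\<integral>\<^sup>+ t. enn_powr (ennreal (t powr (1/p)) * maxrearr f t) (enn2real q)
                         * ennreal (1 / t) * indicator {0<..} t \<partial>lborel) (1 / enn2real q))"

definition lorentz_qnorm :: "real \<Rightarrow> ennreal \<Rightarrow> ('a::euclidean_space \<Rightarrow> real) \<Rightarrow> ennreal" where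
  "lorentz_qnorm p q f =
    (if q = \<infinity> then (SUP t\<in>{0<..}. ennreal (t powr (1/p)) * rearr f t)
     else enn_powr (\<integral>\<^sup>+ t. enn_powr (ennreal (t powr (1/p)) * rearr f t) (enn2real q)
                         * ennreal (1 / t) * indicator {0<..} t \<partial>lborel) (1 / enn2real q))"

end

theory Submission
  imports Defs
begin

text \<open>
  Writing both rearrangements as superpositions of indicators of level sets gives the O'Neil
  inequality \<open>(f g)**(t) \<le> 1/t \<integral>\<^sub>0\<^sup>t f* g*\<close>. Hardy's inequality bounds the norm of the right-hand
  side in \<open>L\<^sup>q(dt/t)\<close> by \<open>p'\<close> times that of \<open>t\<^bsup>1/p\<^esup> f* g*\<close>. Let \<open>1/r = 1/q\<^sub>1 + 1/q\<^sub>2\<close>, so \<open>r \<le> q\<close>.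
  As \<open>f* g*\<close> is non-increasing, \<open>t\<^bsup>1/p\<^esup> f* g*\<close> is bounded by \<open>(r/p)\<^bsup>1/r\<^esup> \<le> e\<^bsup>1/e\<^esup>\<close> times its norm in
  \<open>L\<^sup>r(dt/t)\<close>, hence passing from \<open>q\<close> to \<open>r\<close> costs at most \<open>e\<^bsup>1/e\<^esup>\<close>. Hoelder's inequality with
  exponents \<open>q\<^sub>1, q\<^sub>2\<close> (possibly \<open>r < 1\<close>) concludes.
\<close>

section \<open>Powers and integrals of extended nonnegative reals\<close>

lemma ennreal_inverse_inverse: "inverse (inverse x) = (x :: ennreal)"
  using one_divide_one_divide_ennreal[of x] by (simp add: divide_ennreal_def)

lemma ennreal_inverse_antimono: "x \<le> y \<Longrightarrow> inverse y \<le> (inverse x :: ennreal)"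
  by (cases x; cases y; cases "x = 0") (auto simp: inverse_ennreal top_unique intro!: ennreal_leI le_imp_inverse_le)

lemma enn_powr_ennreal: "0 \<le> x \<Longrightarrow> enn_powr (ennreal x) a = ennreal (x powr a)"
  by (simp add: enn_powr_def)

lemma enn_powr_top [simp]: "enn_powr top a = top"
  by (simp add: enn_powr_def)

lemma enn_powr_0 [simp]: "enn_powr 0 a = 0"
  by (simp add: enn_powr_def)

lemma enn_powr_1 [simp]: "enn_powr x 1 = x"
  by (cases x) (auto simp: enn_powr_def)

lemma enn_powr_one [simp]: "enn_powr 1 a = 1"
  by (simp add: enn_powr_def)

lemma enn_powr_eq_0_iff [simp]: "enn_powr x a = 0 \<longleftrightarrow> x = 0"
  by (cases x) (auto simp: enn_powr_def)

lemma enn_powr_eq_top_iff [simp]: "enn_powr x a = top \<longleftrightarrow> x = top"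
  by (cases x) (auto simp: enn_powr_def)

lemma enn_powr_mono:
  assumes "0 \<le> a" "x \<le> y"
  shows "enn_powr x a \<le> enn_powr y a"
  using assms by (cases x; cases y) (auto simp: enn_powr_def powr_mono2 top_unique)

lemma enn_powr_mult: "enn_powr (x * y) a = enn_powr x a * enn_powr y a"
proof -
  have "enn_powr (top * y) a = top * enn_powr y a" for y
    by (cases "y = 0") (auto simp: ennreal_top_mult)
  moreover have "enn_powr (x * top) a = enn_powr x a * top"
    by (cases "x = 0") (auto simp: ennreal_mult_top)
  ultimately show ?thesis
    by (cases x; cases y) (auto simp: enn_powr_ennreal ennreal_mult[symmetric] powr_mult)
qed

lemma enn_powr_powr: "enn_powr (enn_powr x a) b = enn_powr x (a * b)"
  by (cases x) (auto simp: enn_powr_ennreal powr_powr)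

lemma enn_powr_inverse:
  assumes "a \<noteq> 0" shows "enn_powr (enn_powr x a) (1 / a) = x"
    and "enn_powr (enn_powr x (1 / a)) a = x"
  using assms by (simp_all add: enn_powr_powr)

text \<open>As 0 and \<open>top\<close> are fixed points of \<open>enn_powr\<close> for every
  exponent, 0 included, exponents may cancel or be negative without producing an indeterminate
  form.\<close>

lemma enn_powr_add: "enn_powr x (a + b) = enn_powr x a * enn_powr x b"
  by (cases x) (auto simp: enn_powr_ennreal ennreal_mult[symmetric] powr_add ennreal_top_mult)

lemma borel_measurable_enn_powr [measurable (raw)]:
  assumes [measurable]: "f \<in> borel_measurable M"
  shows "(\<lambda>x. enn_powr (f x) a) \<in> borel_measurable M"
proof -
  have [measurable]: "Measurable.pred M (\<lambda>x. f x = \<infinity>)"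
    by (rule pred_eq_const1[OF assms]) simp
  show ?thesis unfolding enn_powr_def by measurable
qed

text \<open>Superlevel sets of a non-increasing function are intervals, hence Borel. Measurability
  of rearrangements and distribution functions rests on this.\<close>

lemma borel_measurable_antimono_ennreal:
  fixes f :: "real \<Rightarrow> ennreal"
  assumes "antimono f"
  shows "f \<in> borel_measurable borel"
proof (rule borel_measurableI_greater)
  fix a
  have "is_interval {x. a < f x}"
    unfolding is_interval_1 using assms by (auto simp: antimono_def) (meson less_le_trans)
  then show "{x \<in> space borel. a < f x} \<in> sets borel"
    by (simp add: real_interval_borel_measurable)
qed

text \<open>Dividing \<open>u\<close> and \<open>v\<close> by their integrals reduces the claim to
  total mass 1, where a pointwise weighted mean inequality integrates to \<open>a + b = 1\<close>.
  Integrals equal to 0 or \<open>top\<close> forbid the division and are treated first.\<close>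

lemma nn_integral_Holder:
  assumes [measurable]: "u \<in> borel_measurable M" "v \<in> borel_measurable M"
    and ab: "0 < a" "0 < b" "a + b = (1::real)"
  shows "(\<integral>\<^sup>+x. enn_powr (u x) a * enn_powr (v x) b \<partial>M)
    \<le> enn_powr (\<integral>\<^sup>+x. u x \<partial>M) a * enn_powr (\<integral>\<^sup>+x. v x \<partial>M) b"
proof -
  define U where "U = (\<integral>\<^sup>+x. u x \<partial>M)"
  define V where "V = (\<integral>\<^sup>+x. v x \<partial>M)"
  consider "U = 0 \<or> V = 0" | "U \<noteq> 0" "V \<noteq> 0" "U = top \<or> V = top" 
    | "U \<noteq> 0" "V \<noteq> 0" "U \<noteq> top" "V \<noteq> top" by blast
  then show ?thesis
  proof cases
    case 1
    then have "AE x in M. u x = 0 \<or> v x = 0"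
      unfolding U_def V_def by (auto simp: nn_integral_0_iff_AE)
    then have "AE x in M. enn_powr (u x) a * enn_powr (v x) b = 0"
      by eventually_elim auto
    then have "(\<integral>\<^sup>+x. enn_powr (u x) a * enn_powr (v x) b \<partial>M) = 0"
      by (subst nn_integral_0_iff_AE) auto
    then show ?thesis by simp
  next
    case 2
    then have "enn_powr U a * enn_powr V b = top"
      by (auto simp: ennreal_top_mult ennreal_mult_top)
    then show ?thesis by (simp add: U_def V_def)
  next
    case 3
    \<comment> \<open>Weighted arithmetic-geometric mean inequality; at an infinite argument the
      right side is \<open>top\<close> because both weights are positive.\<close>
    have young: "enn_powr x a * enn_powr y b \<le> ennreal a * x + ennreal b * y" for x y
    proof (cases "x = top \<or> y = top")
      case True
      then show ?thesis using ab by (auto simp: ennreal_mult_top)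
    next
      case False
      then obtain x' y' where "x = ennreal x'" "y = ennreal y'" "0 \<le> x'" "0 \<le> y'"
        by (metis ennreal_cases)
      then show ?thesis
        using Youngs_inequality_0[of a b x' y'] ab
        by (cases "x' = 0 \<or> y' = 0") (auto simp: enn_powr_ennreal ennreal_mult[symmetric] ennreal_plus[symmetric] intro!: ennreal_leI simp del: ennreal_plus)
    qed
    have *: "enn_powr (u x) a * enn_powr (v x) b =
       (enn_powr U a * enn_powr V b) * (enn_powr (u x / U) a * enn_powr (v x / V) b)" for x
    proof -
      have "u x = U * (u x / U)" "v x = V * (v x / V)"
        using 3 by (simp_all add: ennreal_times_divide mult.commute[of U] mult.commute[of V] mult_divide_eq_ennreal)
      then show ?thesis by (metis (no_types, lifting) enn_powr_mult mult.assoc mult.left_commute)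
    qed
    have "(\<integral>\<^sup>+x. enn_powr (u x) a * enn_powr (v x) b \<partial>M) =
      (enn_powr U a * enn_powr V b) * (\<integral>\<^sup>+x. enn_powr (u x / U) a * enn_powr (v x / V) b \<partial>M)"
      by (subst *, subst nn_integral_cmult) auto
    also have "(\<integral>\<^sup>+x. enn_powr (u x / U) a * enn_powr (v x / V) b \<partial>M)
      \<le> (\<integral>\<^sup>+x. ennreal a * (u x / U) + ennreal b * (v x / V) \<partial>M)"
      by (intro nn_integral_mono young)
    also have "\<dots> = ennreal a * (U / U) + ennreal b * (V / V)"
      by (simp add: nn_integral_add nn_integral_cmult nn_integral_divide U_def V_def)
    also have "\<dots> = 1"
      using 3 ab by (simp add: ennreal_divide_self top.not_eq_extremum flip: ennreal_plus)
    finally show ?thesis by (simp add: U_def V_def mult_left_mono)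
  qed
qed

lemma nn_integral_powr_from_0:
  assumes "- 1 < a" "0 \<le> t"
  shows "(\<integral>\<^sup>+s. ennreal (s powr a) * indicator {0<..t} s \<partial>lborel) = ennreal (t powr (a + 1) / (a + 1))"
proof -
  have "(\<integral>\<^sup>+s. ennreal (s powr a) * indicator {0<..t} s \<partial>lborel)
    = (\<integral>\<^sup>+s. ennreal (s powr a) * indicator {0..t} s \<partial>lborel)"
    by (intro nn_integral_cong) (auto simp: indicator_def)
  also have "\<dots> = (\<integral>\<^sup>+s. ennreal (indicator {0..t} s * s powr a) \<partial>lborel)"
    by (intro nn_integral_cong) (auto simp: indicator_def)
  also have "\<dots> = ennreal (t powr (a + 1) / (a + 1))"
    by (rule nn_integral_has_integral_lebesgue[OF _ has_integral_powr_from_0]) (use assms in auto)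
  finally show ?thesis .
qed

lemma nn_integral_powr_to_inf:
  assumes "a < - 1" "0 < s"
  shows "(\<integral>\<^sup>+t. ennreal (t powr a) * indicator {s..} t \<partial>lborel) = ennreal (- (s powr (a + 1)) / (a + 1))"
proof -
  have "(\<integral>\<^sup>+t. ennreal (t powr a) * indicator {s..} t \<partial>lborel)
    = (\<integral>\<^sup>+t. ennreal (indicator {s..} t * t powr a) \<partial>lborel)"
    by (intro nn_integral_cong) (auto simp: indicator_def)
  also have "\<dots> = ennreal (- (s powr (a + 1)) / (a + 1))"
    by (rule nn_integral_has_integral_lebesgue[OF _ has_integral_powr_to_inf]) (use assms in auto)
  finally show ?thesis .
qed

section \<open>Norms with respect to dt/t\<close>

text \<open>The norm of L^q((0,\<infinity>), dt/t), through which both Lorentz functionals factor.\<close>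

definition scale_norm :: "ennreal \<Rightarrow> (real \<Rightarrow> ennreal) \<Rightarrow> ennreal" where
  "scale_norm q u =
    (if q = \<infinity> then (SUP t\<in>{0<..}. u t)
     else enn_powr (\<integral>\<^sup>+ t. enn_powr (u t) (enn2real q) * ennreal (1 / t) * indicator {0<..} t \<partial>lborel)
       (1 / enn2real q))"

lemma lorentz_norm_eq_scale_norm:
  "lorentz_norm p q f = scale_norm q (\<lambda>t. ennreal (t powr (1/p)) * maxrearr f t)"
  by (simp add: lorentz_norm_def scale_norm_def)

lemma lorentz_qnorm_eq_scale_norm:
  "lorentz_qnorm p q f = scale_norm q (\<lambda>t. ennreal (t powr (1/p)) * rearr f t)"
  by (simp add: lorentz_qnorm_def scale_norm_def)

lemma scale_norm_top: "scale_norm top u = (SUP t\<in>{0<..}. u t)"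
  by (simp add: scale_norm_def)

lemma scale_norm_ennreal:
  "0 \<le> a \<Longrightarrow> scale_norm (ennreal a) u =
    enn_powr (\<integral>\<^sup>+ t. enn_powr (u t) a * ennreal (1 / t) * indicator {0<..} t \<partial>lborel) (1 / a)"
  by (simp add: scale_norm_def)

lemma scale_norm_mono:
  assumes "\<And>t. 0 < t \<Longrightarrow> u t \<le> v t"
  shows "scale_norm q u \<le> scale_norm q v"
proof (cases q)
  case (real a)
  have "(\<integral>\<^sup>+ t. enn_powr (u t) a * ennreal (1 / t) * indicator {0<..} t \<partial>lborel)
    \<le> (\<integral>\<^sup>+ t. enn_powr (v t) a * ennreal (1 / t) * indicator {0<..} t \<partial>lborel)"
    using assms real by (intro nn_integral_mono) (auto simp: indicator_def intro!: mult_right_mono enn_powr_mono)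
  then show ?thesis
    using real by (simp add: scale_norm_ennreal enn_powr_mono)
next
  case top
  then show ?thesis using assms by (auto simp: scale_norm_top intro!: SUP_mono)
qed

lemma scale_norm_cong:
  assumes "\<And>t. 0 < t \<Longrightarrow> u t = v t"
  shows "scale_norm q u = scale_norm q v"
  using assms by (intro antisym scale_norm_mono) auto

section \<open>Hoelder's inequality for the measure dt/t\<close>

lemma scale_norm_Holder_top:
  assumes [measurable]: "v \<in> borel_measurable borel" and "0 < q"
  shows "scale_norm q (\<lambda>t. u t * v t) \<le> scale_norm top u * scale_norm q v"
proof (cases q)
  case (real a)
  then have a: "0 < a" using assms by simp
  define S where "S = scale_norm top u"
  have S: "u t \<le> S" if "0 < t" for t
    using that by (auto simp: S_def scale_norm_top intro: SUP_upper)
  have "(\<integral>\<^sup>+ t. enn_powr (u t * v t) a * ennreal (1 / t) * indicator {0<..} t \<partial>lborel)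
    \<le> (\<integral>\<^sup>+ t. enn_powr S a * (enn_powr (v t) a * ennreal (1 / t) * indicator {0<..} t) \<partial>lborel)"
    using a S by (intro nn_integral_mono)
      (auto simp: indicator_def enn_powr_mult mult.assoc intro!: mult_right_mono enn_powr_mono)
  also have "\<dots> = enn_powr S a * (\<integral>\<^sup>+ t. enn_powr (v t) a * ennreal (1 / t) * indicator {0<..} t \<partial>lborel)"
    by (rule nn_integral_cmult) auto
  finally have "scale_norm q (\<lambda>t. u t * v t) \<le> enn_powr \<dots> (1 / a)"
    using a real by (simp add: scale_norm_ennreal enn_powr_mono)
  also have "\<dots> = S * scale_norm q v"
    using a real by (simp add: scale_norm_ennreal enn_powr_mult enn_powr_inverse)
  finally show ?thesis by (simp add: S_def)
next
  case top
  then show ?thesis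
    by (auto simp: scale_norm_top intro!: SUP_least mult_mono SUP_upper)
qed

text \<open>For finite exponents, \<open>u^a\<close> and \<open>v^b\<close> enter
  \<open>nn_integral_Holder\<close> with weights \<open>r/a\<close> and \<open>r/b\<close>. All that
  matters is that these are positive with sum 1, so \<open>r\<close> may be below 1. An infinite
  exponent has inverse 0 and leads to \<open>scale_norm_Holder_top\<close>.\<close>

lemma scale_norm_Holder:
  assumes [measurable]: "u \<in> borel_measurable borel" "v \<in> borel_measurable borel"
    and q: "0 < q1" "0 < q2"
  shows "scale_norm (inverse (inverse q1 + inverse q2)) (\<lambda>t. u t * v t)
    \<le> scale_norm q1 u * scale_norm q2 v"
proof -
  consider "q1 = top" | "q2 = top" | "q1 \<noteq> top" "q2 \<noteq> top" by blast
  then show ?thesis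
  proof cases
    case 1
    then show ?thesis using scale_norm_Holder_top[of v q2 u] q by (simp add: ennreal_inverse_inverse)
  next
    case 2
    then show ?thesis using scale_norm_Holder_top[of u q1 v] q by (simp add: ennreal_inverse_inverse mult.commute)
  next
    case 3
    then obtain a b where ab: "q1 = ennreal a" "q2 = ennreal b" "0 < a" "0 < b"
      using q by (metis ennreal_cases ennreal_less_zero_iff)
    define r where "r = 1 / (1 / a + 1 / b)"
    have r: "0 < r" "r / a + r / b = 1"
    proof -
      have pos: "0 < 1 / a + 1 / b" using ab by (simp add: add_pos_pos)
      then show "0 < r" by (simp add: r_def)
      have "r / a + r / b = r * (1 / a + 1 / b)" by (simp add: algebra_simps)
      then show "r / a + r / b = 1" using pos by (simp add: r_def)
    qed
    have "inverse (inverse q1 + inverse q2) = ennreal r"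
      using ab by (simp add: inverse_ennreal r_def divide_inverse add_pos_pos flip: ennreal_plus)
    moreover have "(\<integral>\<^sup>+ t. enn_powr (u t * v t) r * ennreal (1 / t) * indicator {0<..} t \<partial>lborel)
      \<le> enn_powr (\<integral>\<^sup>+ t. enn_powr (u t) a * ennreal (1 / t) * indicator {0<..} t \<partial>lborel) (r / a)
       * enn_powr (\<integral>\<^sup>+ t. enn_powr (v t) b * ennreal (1 / t) * indicator {0<..} t \<partial>lborel) (r / b)"
    proof -
      \<comment> \<open>The weight of dt/t stays inside the integrand, so that it can be shared
        between the two factors as \<open>w^(r/a)\<close> and \<open>w^(r/b)\<close>.\<close>
      define w :: "real \<Rightarrow> ennreal" where "w t = ennreal (1 / t) * indicator {0<..} t" for t
      have [measurable]: "w \<in> borel_measurable borel" unfolding w_def by measurable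
      have "enn_powr (w t) (r / a) * enn_powr (w t) (r / b) = w t" for t
        using r by (simp flip: enn_powr_add)
      then have "enn_powr (u t * v t) r * w t =
        enn_powr (enn_powr (u t) a * w t) (r / a) * enn_powr (enn_powr (v t) b * w t) (r / b)" for t
        using ab by (simp add: enn_powr_mult enn_powr_powr mult_ac)
      then have "(\<integral>\<^sup>+ t. enn_powr (u t * v t) r * w t \<partial>lborel)
        \<le> enn_powr (\<integral>\<^sup>+ t. enn_powr (u t) a * w t \<partial>lborel) (r / a)
       * enn_powr (\<integral>\<^sup>+ t. enn_powr (v t) b * w t \<partial>lborel) (r / b)"
        using ab r nn_integral_Holder[of "\<lambda>t. enn_powr (u t) a * w t" lborel "\<lambda>t. enn_powr (v t) b * w t" "r / a" "r / b"]
        by simp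
      then show ?thesis by (simp add: w_def mult.assoc)
    qed
    then have "enn_powr (\<integral>\<^sup>+ t. enn_powr (u t * v t) r * ennreal (1 / t) * indicator {0<..} t \<partial>lborel) (1 / r)
      \<le> enn_powr \<dots> (1 / r)"
      using r by (intro enn_powr_mono) auto
    ultimately show ?thesis
      using r ab by (simp add: scale_norm_ennreal enn_powr_mult enn_powr_powr)
  qed
qed

section \<open>Lowering the second exponent for non-increasing functions\<close>

lemma root_le_exp_inverse_exp:
  assumes "0 < r" "1 \<le> (p::real)"
  shows "(r / p) powr (1 / r) \<le> exp (1 / exp 1)"
proof -
  \<comment> \<open>The tangent of the logarithm at e gives \<open>ln r <= r / e\<close>, with
    equality at \<open>r = e\<close>; this is where \<open>e^(1/e)\<close> comes from.\<close>
  have "ln (r / exp 1) \<le> r / exp 1 - 1"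
    using assms by (intro ln_le_minus_one) auto
  then have "ln r \<le> r / exp 1"
    using assms by (simp add: ln_div)
  moreover have "ln (r / p) \<le> ln r"
    using assms by (simp add: ln_div)
  ultimately have "ln (r / p) \<le> r / exp 1"
    by simp
  then have "ln (r / p) / r \<le> 1 / exp 1"
    using assms by (simp add: divide_simps mult.commute)
  then show ?thesis
    using assms by (simp add: powr_def)
qed

text \<open>Restricting the integral to \<open>(0, t]\<close>, where \<open>h s >= h t\<close>,
  leaves \<open>h(t)^r\<close> times the integral of \<open>s^(r/p - 1)\<close>, that is
  \<open>(p/r) t^(r/p) h(t)^r\<close>. The r-th root then produces the factor
  \<open>(r/p)^(1/r)\<close>.\<close>

lemma antimono_le_scale_norm:
  fixes h :: "real \<Rightarrow> ennreal"
  assumes "antimono h" "0 < r" "1 \<le> p" "0 < t"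
  shows "ennreal (t powr (1 / p)) * h t
    \<le> ennreal (exp (1 / exp 1)) * scale_norm (ennreal r) (\<lambda>s. ennreal (s powr (1 / p)) * h s)"
proof -
  define I where "I = (\<integral>\<^sup>+ s. enn_powr (ennreal (s powr (1 / p)) * h s) r * ennreal (1 / s) * indicator {0<..} s \<partial>lborel)"
  have "ennreal (t powr (r / p) / (r / p)) * enn_powr (h t) r
    = (\<integral>\<^sup>+s. ennreal (s powr (r / p - 1)) * indicator {0<..t} s \<partial>lborel) * enn_powr (h t) r"
    using assms by (subst nn_integral_powr_from_0) auto
  also have "\<dots> = (\<integral>\<^sup>+s. ennreal (s powr (r / p - 1)) * indicator {0<..t} s * enn_powr (h t) r \<partial>lborel)"
    by (rule nn_integral_multc[symmetric]) auto
  also have "\<dots> \<le> I"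
    unfolding I_def
  proof (rule nn_integral_mono)
    fix s
    have "ennreal (s powr (r / p - 1)) * enn_powr (h t) r
        \<le> enn_powr (ennreal (s powr (1 / p)) * h s) r * ennreal (1 / s)" if "0 < s" "s \<le> t"
    proof -
      have "ennreal (s powr (r / p - 1)) * enn_powr (h t) r = 
        enn_powr (ennreal (s powr (1 / p)) * h t) r * ennreal (1 / s)"
        using that by (simp add: enn_powr_mult enn_powr_ennreal powr_powr powr_diff divide_inverse ennreal_mult mult_ac)
      also have "\<dots> \<le> enn_powr (ennreal (s powr (1 / p)) * h s) r * ennreal (1 / s)"
        using that assms by (intro mult_right_mono enn_powr_mono mult_left_mono) (auto simp: antimono_def)
      finally show ?thesis .
    qed
    then show "ennreal (s powr (r / p - 1)) * indicator {0<..t} s * enn_powr (h t) r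
         \<le> enn_powr (ennreal (s powr (1 / p)) * h s) r * ennreal (1 / s) * indicator {0<..} s"
      by (auto simp: indicator_def)
  qed
  finally have "ennreal (r / p) * (ennreal (t powr (r / p) / (r / p)) * enn_powr (h t) r) \<le> ennreal (r / p) * I"
    by (rule mult_left_mono) simp
  moreover have "ennreal (r / p) * (ennreal (t powr (r / p) / (r / p)) * enn_powr (h t) r)
    = enn_powr (ennreal (t powr (1 / p)) * h t) r"
    using assms by (simp add: enn_powr_mult enn_powr_ennreal powr_powr mult.assoc[symmetric] ennreal_mult[symmetric])
  ultimately have "enn_powr (enn_powr (ennreal (t powr (1 / p)) * h t) r) (1 / r) \<le> enn_powr (ennreal (r / p) * I) (1 / r)"
    using assms by (intro enn_powr_mono) auto
  then have "ennreal (t powr (1 / p)) * h t \<le> ennreal ((r / p) powr (1 / r)) * enn_powr I (1 / r)"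
    using assms by (simp add: enn_powr_inverse enn_powr_mult[of "ennreal (r / p)"] enn_powr_ennreal)
  also have "\<dots> \<le> ennreal (exp (1 / exp 1)) * enn_powr I (1 / r)"
    using assms by (intro mult_right_mono ennreal_leI root_le_exp_inverse_exp) auto
  finally show ?thesis
    using assms by (simp add: scale_norm_ennreal I_def)
qed

text \<open>Interpolation between the pointwise bound \<open>S\<close> from
  \<open>antimono_le_scale_norm\<close> and the exponent \<open>r\<close>: for finite exponents,
  \<open>u^b = u^(b-a) u^a <= S^(b-a) u^a\<close>.\<close>

lemma scale_norm_embedding:
  fixes h :: "real \<Rightarrow> ennreal"
  assumes h: "antimono h" and "0 < r" "r \<le> q" "1 \<le> p"
  shows "scale_norm q (\<lambda>s. ennreal (s powr (1 / p)) * h s)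
    \<le> ennreal (exp (1 / exp 1)) * scale_norm r (\<lambda>s. ennreal (s powr (1 / p)) * h s)"
proof (cases r)
  case top
  \<comment> \<open>An infinite \<open>r\<close> forces \<open>q = r\<close>, and the claim reduces
    to the constant being at least 1.\<close>
  then have "q = r" using assms by (simp add: top_unique)
  moreover have "1 * x \<le> ennreal (exp (1 / exp 1)) * x" for x
    by (intro mult_right_mono) auto
  ultimately show ?thesis by simp
next
  case (real a)
  then have a: "0 < a" using assms by simp
  define u where "u s = ennreal (s powr (1 / p)) * h s" for s
  define S where "S = ennreal (exp (1 / exp 1)) * scale_norm r u"
  have S: "u t \<le> S" if "0 < t" for t
    using antimono_le_scale_norm[OF h a assms(4) that] real by (simp add: S_def u_def[abs_def])
  have "scale_norm q u \<le> S"
  proof (cases q)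
    case top
    then show ?thesis using S by (auto simp: scale_norm_top intro!: SUP_least)
  next
    case (real b)
    have ab: "a \<le> b" "0 < b" using \<open>r \<le> q\<close> real a \<open>r = ennreal a\<close> by (simp_all add: ennreal_le_iff)
    have [measurable]: "h \<in> borel_measurable borel"
      using h by (rule borel_measurable_antimono_ennreal)
    have [measurable]: "u \<in> borel_measurable borel" unfolding u_def by measurable
    have "(\<integral>\<^sup>+ t. enn_powr (u t) b * ennreal (1 / t) * indicator {0<..} t \<partial>lborel)
      \<le> (\<integral>\<^sup>+ t. enn_powr S (b - a) * (enn_powr (u t) a * ennreal (1 / t) * indicator {0<..} t) \<partial>lborel)"
    proof (rule nn_integral_mono)
      fix t :: real
      have "enn_powr (u t) b = enn_powr (u t) (b - a) * enn_powr (u t) a"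
        by (simp flip: enn_powr_add)
      then show "enn_powr (u t) b * ennreal (1 / t) * indicator {0<..} t
        \<le> enn_powr S (b - a) * (enn_powr (u t) a * ennreal (1 / t) * indicator {0<..} t)"
        using S[of t] ab
        by (auto simp: indicator_def mult.assoc intro!: mult_right_mono enn_powr_mono)
    qed
    also have "\<dots> = enn_powr S (b - a) * (\<integral>\<^sup>+ t. enn_powr (u t) a * ennreal (1 / t) * indicator {0<..} t \<partial>lborel)"
      by (rule nn_integral_cmult) auto
    also have "\<dots> = enn_powr S (b - a) * enn_powr (scale_norm r u) a"
      using a \<open>r = ennreal a\<close> by (simp add: scale_norm_ennreal enn_powr_inverse)
    \<comment> \<open>As the constant in \<open>S\<close> is at least 1, the remaining norm may be
      enlarged to \<open>S\<close>, and the powers add up to \<open>S^b\<close>.\<close>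
    also have "\<dots> \<le> enn_powr S (b - a) * enn_powr S a"
    proof -
      have "1 * scale_norm r u \<le> S"
        unfolding S_def by (intro mult_right_mono) auto
      then show ?thesis using a by (intro mult_left_mono enn_powr_mono) auto
    qed
    also have "\<dots> = enn_powr S b"
      by (simp flip: enn_powr_add)
    finally have "scale_norm q u \<le> enn_powr (enn_powr S b) (1 / b)"
      using ab real by (simp add: scale_norm_ennreal enn_powr_mono)
    then show ?thesis using ab by (simp add: enn_powr_inverse)
  qed
  then show ?thesis by (simp add: S_def u_def[abs_def])
qed

section \<open>Jensen's and Hardy's inequalities\<close>

lemma enn_powr_nn_integral_le:
  assumes [measurable]: "w \<in> borel_measurable M" "k \<in> borel_measurable M"
    and k: "(\<integral>\<^sup>+x. k x \<partial>M) = 1" and q: "1 \<le> q"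
  shows "enn_powr (\<integral>\<^sup>+x. w x * k x \<partial>M) q \<le> (\<integral>\<^sup>+x. enn_powr (w x) q * k x \<partial>M)"
proof (cases "q = 1")
  case False
  \<comment> \<open>Jensen's inequality as a case of Hoelder's: \<open>w k\<close> is split into
    \<open>(w^q k)^(1/q)\<close> and \<open>k^(1 - 1/q)\<close>, and the second factor contributes 1
    since \<open>k\<close> has mass 1.\<close>
  have eq: "enn_powr (enn_powr (w x) q * k x) (1 / q) * enn_powr (k x) (1 - 1 / q) = w x * k x" for x
  proof -
    have "enn_powr (k x) (1 / q) * enn_powr (k x) (1 - 1 / q) = k x"
      by (simp flip: enn_powr_add)
    then show ?thesis using q by (simp add: enn_powr_mult enn_powr_inverse mult.assoc)
  qed
  have "(\<integral>\<^sup>+x. w x * k x \<partial>M) \<le> enn_powr (\<integral>\<^sup>+x. enn_powr (w x) q * k x \<partial>M) (1 / q)"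
    using nn_integral_Holder[of "\<lambda>x. enn_powr (w x) q * k x" M k "1 / q" "1 - 1 / q"] q False k
    by (simp add: eq)
  then have "enn_powr (\<integral>\<^sup>+x. w x * k x \<partial>M) q
    \<le> enn_powr (enn_powr (\<integral>\<^sup>+x. enn_powr (w x) q * k x \<partial>M) (1 / q)) q"
    using q by (intro enn_powr_mono) auto
  then show ?thesis using q by (simp add: enn_powr_inverse)
qed simp

text \<open>The average of h over (0,t], scaled by t^(1/p), is p' times the mean of s^(1/p) h(s) against
  the probability density k t proportional to s^(-1/p) on (0,t]. Jensen's inequality for this density
  and Tonelli give the sharp constant p'.\<close>

lemma scale_norm_Hardy:
  assumes h [measurable]: "h \<in> borel_measurable borel" and p: "1 < p" and q: "1 \<le> q"
  shows "scale_norm q (\<lambda>t. ennreal (t powr (1 / p)) * (ennreal (1 / t) * (\<integral>\<^sup>+s. h s * indicator {0<..t} s \<partial>lborel)))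
    \<le> ennreal (p / (p - 1)) * scale_norm q (\<lambda>t. ennreal (t powr (1 / p)) * h t)"
proof -
  \<comment> \<open>The reciprocal of \<open>p'\<close>. Its positivity makes
    \<open>s^(\<beta> - 1)\<close> integrable at 0 and \<open>t^(-\<beta> - 1)\<close> integrable at
    infinity.\<close>
  define \<beta> where "\<beta> = 1 - 1 / p"
  have \<beta>: "0 < \<beta>" "\<beta> < 1" "1 / p = 1 - \<beta>" "p / (p - 1) = 1 / \<beta>"
    using p by (auto simp: \<beta>_def field_simps)
  define w where "w s = ennreal (s powr (1 / p)) * h s" for s
  define k :: "real \<Rightarrow> real \<Rightarrow> ennreal"
    where "k t s = ennreal (\<beta> * t powr - \<beta> * s powr (\<beta> - 1)) * indicator {0<..t} s" for t s
  have [measurable]: "w \<in> borel_measurable borel" unfolding w_def by measurable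
  \<comment> \<open>The moving interval \<open>{0<..t}\<close> becomes a condition on the pair
    \<open>(t, s)\<close>, which makes joint measurability accessible.\<close>
  have k_alt: "k t s = ennreal (\<beta> * t powr - \<beta> * s powr (\<beta> - 1)) * (if 0 < s \<and> s \<le> t then 1 else 0)" for t s
    by (auto simp: k_def indicator_def)
  have k2 [measurable]: "(\<lambda>(t, s). k t s) \<in> borel_measurable (borel \<Otimes>\<^sub>M borel)"
    unfolding k_alt by measurable
  have [measurable]: "k t \<in> borel_measurable borel" for t
    unfolding k_def[abs_def] by measurable
  have k1: "(\<integral>\<^sup>+s. k t s \<partial>lborel) = 1" if "0 < t" for t
  proof -
    have "(\<integral>\<^sup>+s. k t s \<partial>lborel)
      = ennreal (\<beta> * t powr - \<beta>) * (\<integral>\<^sup>+s. ennreal (s powr (\<beta> - 1)) * indicator {0<..t} s \<partial>lborel)"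
      unfolding k_def using \<beta>
      by (subst nn_integral_cmult[symmetric]) (auto simp: ennreal_mult mult.assoc)
    also have "\<dots> = 1"
      using \<beta> that by (simp add: nn_integral_powr_from_0 ennreal_mult[symmetric] powr_minus)
    finally show ?thesis .
  qed
  \<comment> \<open>The powers \<open>s^(1/p)\<close> in \<open>w\<close> and
    \<open>s^(\<beta> - 1)\<close> in \<open>k\<close> cancel, and
    \<open>t^(-\<beta>) = t^(1/p) / t\<close>.\<close>
  have avg: "ennreal (t powr (1 / p)) * (ennreal (1 / t) * (\<integral>\<^sup>+s. h s * indicator {0<..t} s \<partial>lborel))
    = ennreal (1 / \<beta>) * (\<integral>\<^sup>+s. w s * k t s \<partial>lborel)" if "0 < t" for t
  proof -
    have "(\<integral>\<^sup>+s. w s * k t s \<partial>lborel) = (\<integral>\<^sup>+s. ennreal (\<beta> * t powr - \<beta>) * (h s * indicator {0<..t} s) \<partial>lborel)"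
    proof (rule nn_integral_cong)
      fix s
      have "ennreal (s powr (1 / p)) * ennreal (\<beta> * t powr - \<beta> * s powr (\<beta> - 1)) = ennreal (\<beta> * t powr - \<beta>)" if "0 < s"
      proof -
        have "s powr (1 / p) * s powr (\<beta> - 1) = 1"
          using that \<beta> by (simp flip: powr_add)
        then have "s powr (1 / p) * (\<beta> * t powr - \<beta> * s powr (\<beta> - 1)) = \<beta> * t powr - \<beta>"
          by (simp add: mult_ac)
        then show ?thesis using \<beta> by (subst ennreal_mult[symmetric]) auto
      qed
      then show "w s * k t s = ennreal (\<beta> * t powr - \<beta>) * (h s * indicator {0<..t} s)"
        by (auto simp: w_def k_def indicator_def mult_ac)
    qed
    also have "\<dots> = ennreal (\<beta> * t powr - \<beta>) * (\<integral>\<^sup>+s. h s * indicator {0<..t} s \<partial>lborel)"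
      by (rule nn_integral_cmult) auto
    finally have "ennreal (1 / \<beta>) * (\<integral>\<^sup>+s. w s * k t s \<partial>lborel)
      = ennreal (1 / \<beta> * (\<beta> * t powr - \<beta>)) * (\<integral>\<^sup>+s. h s * indicator {0<..t} s \<partial>lborel)"
      using \<beta> by (subst ennreal_mult) (simp_all add: mult.assoc)
    moreover have "1 / \<beta> * (\<beta> * t powr - \<beta>) = t powr (1 / p) * (1 / t)"
      using that \<beta>(1) unfolding \<beta>(3) by (simp add: powr_diff powr_minus divide_simps)
    ultimately have "ennreal (1 / \<beta>) * (\<integral>\<^sup>+s. w s * k t s \<partial>lborel)
      = ennreal (t powr (1 / p) * (1 / t)) * (\<integral>\<^sup>+s. h s * indicator {0<..t} s \<partial>lborel)"
      by simp
    also have "ennreal (t powr (1 / p) * (1 / t)) = ennreal (t powr (1 / p)) * ennreal (1 / t)"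
      using that by (intro ennreal_mult) auto
    finally show ?thesis by (simp only: mult.assoc)
  qed
  show ?thesis
  proof (cases q)
    case top
    have "ennreal (1 / \<beta>) * (\<integral>\<^sup>+s. w s * k t s \<partial>lborel) \<le> ennreal (1 / \<beta>) * (SUP t\<in>{0<..}. w t)" if "0 < t" for t
    proof (rule mult_left_mono)
      have "(\<integral>\<^sup>+s. w s * k t s \<partial>lborel) \<le> (\<integral>\<^sup>+s. (SUP t\<in>{0<..}. w t) * k t s \<partial>lborel)"
        by (intro nn_integral_mono) (auto simp: k_def indicator_def intro!: mult_right_mono SUP_upper)
      also have "\<dots> = (SUP t\<in>{0<..}. w t)"
        using that by (simp add: nn_integral_cmult k1)
      finally show "(\<integral>\<^sup>+s. w s * k t s \<partial>lborel) \<le> (SUP t\<in>{0<..}. w t)" .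
    qed simp
    then show ?thesis
      using top by (auto simp: scale_norm_top \<beta>(4) avg w_def[symmetric] intro!: SUP_least)
  next
    case (real a)
    then have a: "1 \<le> a" using q by simp
    \<comment> \<open>Integrating the kernel over \<open>t\<close> against dt/t gives back ds/s, so
      after Tonelli no constant beyond \<open>1 / \<beta>\<close> appears.\<close>
    have inner: "(\<integral>\<^sup>+t. k t s * ennreal (1 / t) * indicator {0<..} t \<partial>lborel) = ennreal (1 / s) * indicator {0<..} s" for s
    proof (cases "0 < s")
      case True
      have "(\<integral>\<^sup>+t. k t s * ennreal (1 / t) * indicator {0<..} t \<partial>lborel)
        = (\<integral>\<^sup>+t. ennreal (\<beta> * s powr (\<beta> - 1)) * (ennreal (t powr (- \<beta> - 1)) * indicator {s..} t) \<partial>lborel)"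
        using True \<beta>
        by (intro nn_integral_cong)
          (auto simp: k_def indicator_def ennreal_mult[symmetric] powr_diff powr_minus divide_simps)
      also have "\<dots> = ennreal (\<beta> * s powr (\<beta> - 1)) * (\<integral>\<^sup>+t. ennreal (t powr (- \<beta> - 1)) * indicator {s..} t \<partial>lborel)"
        by (rule nn_integral_cmult) auto
      also have "\<dots> = ennreal (\<beta> * s powr (\<beta> - 1) * (s powr - \<beta> / \<beta>))"
        using True \<beta>(1) by (subst nn_integral_powr_to_inf) (simp_all del: times_divide_eq_right flip: ennreal_mult)
      also have "\<beta> * s powr (\<beta> - 1) * (s powr - \<beta> / \<beta>) = 1 / s"
        using True \<beta> by (simp add: powr_diff powr_minus divide_simps)
      finally show ?thesis using True by simp
    next
      case False
      then show ?thesis by (simp add: k_def)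
    qed
    have "(\<integral>\<^sup>+t. enn_powr (ennreal (1 / \<beta>) * (\<integral>\<^sup>+s. w s * k t s \<partial>lborel)) a * ennreal (1 / t) * indicator {0<..} t \<partial>lborel)
      \<le> (\<integral>\<^sup>+t. enn_powr (ennreal (1 / \<beta>)) a * (\<integral>\<^sup>+s. enn_powr (w s) a * k t s * ennreal (1 / t) * indicator {0<..} t \<partial>lborel) \<partial>lborel)"
    proof (rule nn_integral_mono)
      fix t :: real
      have "enn_powr (\<integral>\<^sup>+s. w s * k t s \<partial>lborel) a \<le> (\<integral>\<^sup>+s. enn_powr (w s) a * k t s \<partial>lborel)" if "0 < t"
        using that a by (intro enn_powr_nn_integral_le k1) auto
      moreover have "(\<integral>\<^sup>+s. enn_powr (w s) a * k t s * ennreal (1 / t) * indicator {0<..} t \<partial>lborel)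
        = (\<integral>\<^sup>+s. enn_powr (w s) a * k t s \<partial>lborel) * ennreal (1 / t) * indicator {0<..} t"
        by (simp add: nn_integral_multc)
      ultimately show "enn_powr (ennreal (1 / \<beta>) * (\<integral>\<^sup>+s. w s * k t s \<partial>lborel)) a * ennreal (1 / t) * indicator {0<..} t
        \<le> enn_powr (ennreal (1 / \<beta>)) a * (\<integral>\<^sup>+s. enn_powr (w s) a * k t s * ennreal (1 / t) * indicator {0<..} t \<partial>lborel)"
        by (auto simp: indicator_def enn_powr_mult mult.assoc intro!: mult_left_mono mult_right_mono)
    qed
    also have "\<dots> = enn_powr (ennreal (1 / \<beta>)) a * (\<integral>\<^sup>+t. (\<integral>\<^sup>+s. enn_powr (w s) a * k t s * ennreal (1 / t) * indicator {0<..} t \<partial>lborel) \<partial>lborel)"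
      by (rule nn_integral_cmult) measurable
    also have "(\<integral>\<^sup>+t. (\<integral>\<^sup>+s. enn_powr (w s) a * k t s * ennreal (1 / t) * indicator {0<..} t \<partial>lborel) \<partial>lborel)
      = (\<integral>\<^sup>+s. (\<integral>\<^sup>+t. enn_powr (w s) a * k t s * ennreal (1 / t) * indicator {0<..} t \<partial>lborel) \<partial>lborel)"
      by (rule lborel_pair.Fubini') measurable
    also have "\<dots> = (\<integral>\<^sup>+s. enn_powr (w s) a * (\<integral>\<^sup>+t. k t s * ennreal (1 / t) * indicator {0<..} t \<partial>lborel) \<partial>lborel)"
      by (subst nn_integral_cmult[symmetric]) (auto simp: mult.assoc)
    also have "\<dots> = (\<integral>\<^sup>+s. enn_powr (w s) a * ennreal (1 / s) * indicator {0<..} s \<partial>lborel)"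
      by (simp only: inner mult.assoc[symmetric])
    finally have *: "(\<integral>\<^sup>+t. enn_powr (ennreal (1 / \<beta>) * (\<integral>\<^sup>+s. w s * k t s \<partial>lborel)) a * ennreal (1 / t) * indicator {0<..} t \<partial>lborel)
      \<le> enn_powr (ennreal (1 / \<beta>)) a * (\<integral>\<^sup>+s. enn_powr (w s) a * ennreal (1 / s) * indicator {0<..} s \<partial>lborel)" .
    have "scale_norm q (\<lambda>t. ennreal (1 / \<beta>) * (\<integral>\<^sup>+s. w s * k t s \<partial>lborel))
      \<le> enn_powr (enn_powr (ennreal (1 / \<beta>)) a * (\<integral>\<^sup>+s. enn_powr (w s) a * ennreal (1 / s) * indicator {0<..} s \<partial>lborel)) (1 / a)"
      using a real * by (auto simp: scale_norm_ennreal intro!: enn_powr_mono)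
    also have "\<dots> = ennreal (1 / \<beta>) * scale_norm q w"
      using a real by (simp add: scale_norm_ennreal enn_powr_mult enn_powr_inverse)
    finally show ?thesis
      by (simp add: \<beta>(4) avg w_def[abs_def] cong: scale_norm_cong)
  qed
qed

section \<open>The rearrangement of a product\<close>

lemma distrib_fun_antimono:
  assumes [measurable]: "f \<in> borel_measurable lebesgue"
  shows "antimono (distrib_fun f)"
proof (rule antimonoI)
  fix y z :: real assume "y \<le> z"
  have "{x. y < \<bar>f x\<bar>} = {x \<in> space lebesgue. y < \<bar>f x\<bar>}" by simp
  also have "\<dots> \<in> sets lebesgue" by measurable
  finally show "distrib_fun f z \<le> distrib_fun f y"
    unfolding distrib_fun_def using \<open>y \<le> z\<close> by (intro emeasure_mono) auto
qed

lemma borel_measurable_distrib_fun: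
  "f \<in> borel_measurable lebesgue \<Longrightarrow> distrib_fun f \<in> borel_measurable borel"
  by (intro borel_measurable_antimono_ennreal distrib_fun_antimono)

lemma rearr_antimono: "antimono (rearr f)"
  unfolding rearr_def
  by (intro antimonoI INF_superset_mono) (auto intro: less_le_trans ennreal_leI)

lemma borel_measurable_rearr [measurable]: "rearr f \<in> borel_measurable borel"
  by (intro borel_measurable_antimono_ennreal rearr_antimono)

text \<open>Since \<open>distrib_fun f\<close> is non-increasing, the nonnegative levels that fail
  the condition in the infimum form an initial interval, whose length is that infimum. For
  \<open>s <= 0\<close> both sides are \<open>top\<close>.\<close>

lemma rearr_eq_nn_integral:
  assumes f: "f \<in> borel_measurable lebesgue"
  shows "rearr f s = (\<integral>\<^sup>+y. (if 0 \<le> y \<and> ennreal s \<le> distrib_fun f y then 1 else 0) \<partial>lborel)"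
proof -
  have [measurable]: "distrib_fun f \<in> borel_measurable borel"
    using f by (rule borel_measurable_distrib_fun)
  define B where "B = {y. 0 \<le> y \<and> ennreal s \<le> distrib_fun f y}"
  have B [measurable]: "B \<in> sets borel" unfolding B_def by measurable
  have "(\<integral>\<^sup>+y. (if 0 \<le> y \<and> ennreal s \<le> distrib_fun f y then 1 else 0) \<partial>lborel)
    = (\<integral>\<^sup>+y. indicator B y \<partial>lborel)"
    by (intro nn_integral_cong) (auto simp: B_def)
  also have "\<dots> = emeasure lborel B" by simp
  also have "\<dots> = rearr f s"
  proof (rule antisym)
    show "emeasure lborel B \<le> rearr f s"
      unfolding rearr_def
    proof (rule INF_greatest)
      fix z assume z: "z \<in> {y. 0 \<le> y \<and> distrib_fun f y < ennreal s}"
      have "y \<le> z" if "y \<in> B" for y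
      proof (rule ccontr)
        assume "\<not> y \<le> z"
        then have "distrib_fun f y \<le> distrib_fun f z"
          using distrib_fun_antimono[OF f] by (auto simp: antimono_def)
        then show False using z that by (auto simp: B_def)
      qed
      then have "B \<subseteq> {0..z}" by (auto simp: B_def)
      then have "emeasure lborel B \<le> emeasure lborel {0..z}" by (intro emeasure_mono) auto
      then show "emeasure lborel B \<le> ennreal z" using z by simp
    qed
    show "rearr f s \<le> emeasure lborel B"
    \<comment> \<open>Any \<open>c\<close> strictly below \<open>rearr f s\<close> is finite, even
      when \<open>rearr f s\<close> is \<open>top\<close>.\<close>
    proof (rule dense_le)
      fix c assume c: "c < rearr f s"
      then obtain c' where c': "c = ennreal c'" "0 \<le> c'"
        by (metis ennreal_cases not_top_less)
      have "y \<in> B" if "y \<in> {0..c'}" for y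
      proof (rule ccontr)
        assume "y \<notin> B"
        then have "rearr f s \<le> ennreal y"
          unfolding rearr_def using that by (intro INF_lower) (auto simp: B_def)
        also have "\<dots> \<le> c" using that c' by (simp add: ennreal_leI)
        finally show False using c by simp
      qed
      then have "emeasure lborel {0..c'} \<le> emeasure lborel B" by (intro emeasure_mono) auto
      then show "c \<le> emeasure lborel B" using c' by simp
    qed
  qed
  finally show ?thesis ..
qed

lemma ennreal_eq_nn_integral:
  assumes "0 \<le> x"
  shows "ennreal x = (\<integral>\<^sup>+y. (if 0 \<le> y \<and> y < x then 1 else 0) \<partial>lborel)"
proof -
  have "(\<integral>\<^sup>+y. (if 0 \<le> y \<and> y < x then 1 else 0) \<partial>lborel) = (\<integral>\<^sup>+y. indicator {0..<x} y \<partial>lborel)"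
    by (intro nn_integral_cong) auto
  then show ?thesis using assms by simp
qed

text \<open>As \<open>t\<close> is finite, the minimum is a real \<open>c\<close>, and the
  conditions on \<open>s\<close> cut out \<open>(0, c]\<close>. Minima of measures thus become
  integrals to which Tonelli applies.\<close>

lemma min_eq_nn_integral:
  assumes "0 \<le> t"
  shows "min (ennreal t) m = (\<integral>\<^sup>+s. (if 0 < s \<and> s \<le> t \<and> ennreal s \<le> m then 1 else 0) \<partial>lborel)"
proof -
  obtain c where c: "min (ennreal t) m = ennreal c" "0 \<le> c"
    by (metis ennreal_cases ennreal_neq_top min.cobounded1 top_unique)
  have "ennreal s \<le> ennreal t \<and> ennreal s \<le> m \<longleftrightarrow> s \<le> c" if "0 < s" for s
    using that c by (metis ennreal_le_iff min.bounded_iff)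
  then have "(\<integral>\<^sup>+s. (if 0 < s \<and> s \<le> t \<and> ennreal s \<le> m then 1 else 0) \<partial>lborel) = (\<integral>\<^sup>+s. indicator {0<..c} s \<partial>lborel)"
    using assms by (intro nn_integral_cong) (simp add: indicator_def, blast)
  then show ?thesis using c by simp
qed

text \<open>The weight is the bathtub maximiser: it is 1 above the critical level, 0 below it, and a
  constant on the level set itself, so that its total mass is exactly t when possible.\<close>

lemma (in finite_measure) layer_weight_exists:
  fixes F :: "'a \<Rightarrow> real"
  assumes F [measurable]: "F \<in> borel_measurable M" and F0: "\<And>x. 0 \<le> F x" and t: "0 < t"
  shows "\<exists>\<phi>\<in>borel_measurable M. (\<forall>x. \<phi> x \<le> 1) \<and> (\<integral>\<^sup>+x. \<phi> x \<partial>M) \<le> ennreal t \<and>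
    (\<forall>y\<ge>0. min (ennreal t) (emeasure M {x\<in>space M. y < F x}) \<le> (\<integral>\<^sup>+x. \<phi> x * indicator {x. y < F x} x \<partial>M))"
proof (cases "emeasure M (space M) \<le> ennreal t")
  case True
  have "(\<integral>\<^sup>+x. 1 * indicator {x. y < F x} x \<partial>M) = emeasure M {x\<in>space M. y < F x}" for y
  proof -
    have "(\<integral>\<^sup>+x. 1 * indicator {x. y < F x} x \<partial>M) = (\<integral>\<^sup>+x. indicator {x\<in>space M. y < F x} x \<partial>M)"
      by (intro nn_integral_cong) (auto simp: indicator_def)
    then show ?thesis by simp
  qed
  then show ?thesis using True by (intro bexI[of _ "\<lambda>_. 1"]) auto
next
  case False
  define \<mu> where "\<mu> y = emeasure M {x\<in>space M. y < F x}" for y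
  have \<mu>_mono: "\<mu> z \<le> \<mu> y" if "y \<le> z" for y z
    unfolding \<mu>_def using that by (intro emeasure_mono) auto
  \<comment> \<open>The levels whose superlevel set has mass at most \<open>t\<close>; their infimum
    \<open>y0\<close> is the critical level.\<close>
  define Y where "Y = {y. 0 \<le> y \<and> \<mu> y \<le> ennreal t}"
  define y0 where "y0 = Inf Y"
  have "Y \<noteq> {}"
  proof -
    \<comment> \<open>Finite mass gives continuity from above: the superlevel sets shrink to the
      empty set, so their mass drops below \<open>t\<close>.\<close>
    have "(\<lambda>n. \<mu> (real n)) \<longlonglongrightarrow> emeasure M (\<Inter>n. {x\<in>space M. real n < F x})"
      unfolding \<mu>_def by (intro Lim_emeasure_decseq) (auto simp: decseq_def emeasure_eq_measure)
    also have "(\<Inter>n. {x\<in>space M. real n < F x}) = {}"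
    proof -
      have "\<exists>n. \<not> real n < F x" for x
        using reals_Archimedean2[of "F x"] by (auto intro: less_asym)
      then show ?thesis by auto
    qed
    finally have "eventually (\<lambda>n. \<mu> (real n) < ennreal t) sequentially"
      using t by (intro order_tendstoD) auto
    then obtain n where "\<mu> (real n) < ennreal t"
      using eventually_sequentially by auto
    then have "real n \<in> Y" by (auto simp: Y_def)
    then show ?thesis by auto
  qed
  have bdd: "bdd_below Y" by (rule bdd_belowI[of _ 0]) (auto simp: Y_def)
  have y0: "0 \<le> y0"
    unfolding y0_def using \<open>Y \<noteq> {}\<close> by (intro cInf_greatest) (auto simp: Y_def)
  have below: "ennreal t \<le> \<mu> y" if "0 \<le> y" "y < y0" for y
  proof -
    have "y \<notin> Y" using that bdd cInf_lower[of y Y] by (auto simp: y0_def)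
    then show ?thesis using that by (auto simp: Y_def)
  qed
  have above: "\<mu> y \<le> ennreal t" if "y0 < y" for y
  proof -
    obtain z where "z \<in> Y" "z < y"
      using \<open>y0 < y\<close> \<open>Y \<noteq> {}\<close> bdd unfolding y0_def by (meson cInf_less_iff)
    then show ?thesis using \<mu>_mono[of z y] by (auto simp: Y_def)
  qed
  \<comment> \<open>Continuity from below along levels decreasing to \<open>y0\<close>.\<close>
  have le: "\<mu> y0 \<le> ennreal t"
  proof -
    have "(\<Union>n. {x\<in>space M. y0 + inverse (real (Suc n)) < F x}) = {x\<in>space M. y0 < F x}"
    proof (safe)
      fix x n assume "y0 + inverse (real (Suc n)) < F x"
      moreover have "0 < inverse (real (Suc n))" by simp
      ultimately show "y0 < F x" by linarith
    next
      fix x assume "x \<in> space M" "y0 < F x"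
      then obtain n where "inverse (real (Suc n)) < F x - y0"
        using reals_Archimedean[of "F x - y0"] by auto
      then show "x \<in> (\<Union>n. {x\<in>space M. y0 + inverse (real (Suc n)) < F x})"
        using \<open>x \<in> space M\<close> by (auto intro!: exI[of _ n])
    qed
    then have "\<mu> y0 = (SUP n. \<mu> (y0 + inverse (real (Suc n))))"
      unfolding \<mu>_def
      by (subst SUP_emeasure_incseq)
        (auto simp: incseq_def intro: order_le_less_trans[rotated] intro!: add_left_mono le_imp_inverse_le)
    also have "\<dots> \<le> ennreal t"
      by (intro SUP_least above) simp
    finally show ?thesis .
  qed
  \<comment> \<open>The counterpart from the other side, with the level set included. For
    \<open>y0 = 0\<close> the set is the whole space, whose mass exceeds \<open>t\<close> in the
    present case.\<close>
  have ge: "ennreal t \<le> emeasure M {x\<in>space M. y0 \<le> F x}"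
  proof (cases "y0 = 0")
    case True
    then show ?thesis using False F0 by auto
  next
    case y: False
    \<comment> \<open>Levels increasing to \<open>y0\<close> that stay nonnegative, as
      \<open>below\<close> demands.\<close>
    define z where "z n = y0 - y0 / real (Suc n)" for n
    have z: "0 \<le> z n" "z n < y0" for n
      using y y0 by (auto simp: z_def divide_simps mult_le_cancel_left)
    have zlim: "z \<longlonglongrightarrow> y0"
    proof -
      have "(\<lambda>n. y0 - y0 * inverse (real (Suc n))) \<longlonglongrightarrow> y0 - y0 * 0"
        by (intro tendsto_intros LIMSEQ_inverse_real_of_nat)
      then show ?thesis by (simp add: z_def[abs_def] divide_inverse)
    qed
    have "(\<Inter>n. {x\<in>space M. z n < F x}) = {x\<in>space M. y0 \<le> F x}"
    proof safe
      fix x assume "x \<in> (\<Inter>n. {x\<in>space M. z n < F x})"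
      then show "x \<in> space M" and "y0 \<le> F x"
        by (auto intro!: LIMSEQ_le_const2[OF zlim] intro: less_imp_le)
    qed (use z in \<open>auto intro: less_le_trans\<close>)
    moreover have "decseq (\<lambda>n. {x\<in>space M. z n < F x})"
    proof -
      have "z m \<le> z n" if "m \<le> n" for m n
        using that y0 by (auto simp: z_def intro!: divide_left_mono)
      then show ?thesis by (auto simp: decseq_def intro: le_less_trans)
    qed
    ultimately have "emeasure M {x\<in>space M. y0 \<le> F x} = (INF n. \<mu> (z n))"
      unfolding \<mu>_def by (subst INF_emeasure_decseq) (auto simp: emeasure_eq_measure)
    then show ?thesis
      using z by (auto intro!: INF_greatest below)
  qed
  define a where "a = measure M {x\<in>space M. y0 < F x}"
  define b where "b = measure M {x\<in>space M. F x = y0}"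
  have ab0: "0 \<le> a" "0 \<le> b" by (auto simp: a_def b_def)
  have ea: "emeasure M {x\<in>space M. y0 < F x} = ennreal a"
    and eb: "emeasure M {x\<in>space M. F x = y0} = ennreal b"
    by (auto simp: a_def b_def emeasure_eq_measure)
  have "emeasure M {x\<in>space M. y0 \<le> F x} = ennreal a + ennreal b"
    unfolding ea[symmetric] eb[symmetric]
    by (subst plus_emeasure) (auto intro!: arg_cong[of _ _ "emeasure M"])
  then have ab: "a \<le> t" "t \<le> a + b"
    using le ge ab0 t by (auto simp: \<mu>_def ea simp flip: ennreal_plus)
  \<comment> \<open>The fraction of the level set \<open>{F = y0}\<close> that fills the mass from
    \<open>a\<close> up to \<open>t\<close>. If \<open>b = 0\<close> then \<open>a = t\<close>, and
    the default value 0 of the division is the right one.\<close>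
  define \<theta> where "\<theta> = (t - a) / b"
  have \<theta>: "0 \<le> \<theta>" "\<theta> \<le> 1" "a + \<theta> * b = t"
    using ab ab0 by (auto simp: \<theta>_def divide_simps)
  define \<phi> where "\<phi> x = indicator {x\<in>space M. y0 < F x} x + ennreal \<theta> * indicator {x\<in>space M. F x = y0} x" for x
  have int: "(\<integral>\<^sup>+x. \<phi> x \<partial>M) = ennreal t"
  proof -
    have "(\<integral>\<^sup>+x. \<phi> x \<partial>M) = ennreal a + ennreal \<theta> * ennreal b"
      unfolding \<phi>_def by (subst nn_integral_add) (auto simp: nn_integral_cmult ea eb)
    then show ?thesis using \<theta> ab0 by (simp add: ennreal_mult[symmetric] ennreal_plus[symmetric] del: ennreal_plus)
  qed
  show ?thesis
  proof (intro bexI[of _ \<phi>] conjI allI impI)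
    show "\<phi> \<in> borel_measurable M" unfolding \<phi>_def by measurable
    show "\<phi> x \<le> 1" for x using \<theta> by (auto simp: \<phi>_def indicator_def)
    show "(\<integral>\<^sup>+x. \<phi> x \<partial>M) \<le> ennreal t" using int by simp
    fix y :: real assume "0 \<le> y"
    show "min (ennreal t) (emeasure M {x\<in>space M. y < F x}) \<le> (\<integral>\<^sup>+x. \<phi> x * indicator {x. y < F x} x \<partial>M)"
    \<comment> \<open>For \<open>y < y0\<close> the support of \<open>\<phi>\<close> lies in
      \<open>{y < F}\<close>, so the full mass \<open>t\<close> is counted; otherwise
      \<open>\<phi>\<close> is 1 on \<open>{y < F}\<close>, whose measure is counted.\<close>
    proof (cases "y < y0")
      case True
      then have "(\<integral>\<^sup>+x. \<phi> x * indicator {x. y < F x} x \<partial>M) = (\<integral>\<^sup>+x. \<phi> x \<partial>M)"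
        by (intro nn_integral_cong) (auto simp: \<phi>_def indicator_def)
      then show ?thesis by (simp add: int)
    next
      case False
      have "emeasure M {x\<in>space M. y < F x} = (\<integral>\<^sup>+x. indicator {x\<in>space M. y < F x} x \<partial>M)"
        by simp
      also have "\<dots> \<le> (\<integral>\<^sup>+x. \<phi> x * indicator {x. y < F x} x \<partial>M)"
        using False by (intro nn_integral_mono) (auto simp: \<phi>_def indicator_def)
      finally show ?thesis by (simp add: min.coboundedI2)
    qed
  qed
qed

text \<open>One weight \<open>\<phi>\<close> serves all levels \<open>y\<close> at once, so the left
  side is at most the integral of \<open>\<phi> |F G|\<close>. Slicing \<open>|F|\<close> and
  \<open>|G|\<close> into layers leaves an estimate for each pair of levels, and Tonelli reassembles
  them. The majorants \<open>m\<close> and \<open>n\<close> leave room for the distribution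
  functions of a larger measure.\<close>

lemma (in finite_measure) nn_integral_min_layer_product_le:
  fixes F G :: "'a \<Rightarrow> real"
  assumes [measurable]: "F \<in> borel_measurable M" "G \<in> borel_measurable M"
      "m \<in> borel_measurable borel" "n \<in> borel_measurable borel"
    and m: "\<And>y. emeasure M {x\<in>space M. y < \<bar>F x\<bar>} \<le> m y"
    and n: "\<And>y. emeasure M {x\<in>space M. y < \<bar>G x\<bar>} \<le> n y"
    and t: "0 < t"
  shows "(\<integral>\<^sup>+y. min (ennreal t) (emeasure M {x\<in>space M. y < \<bar>F x * G x\<bar>}) * indicator {0..} y \<partial>lborel)
    \<le> (\<integral>\<^sup>+s. (\<integral>\<^sup>+a. (if 0 \<le> a \<and> ennreal s \<le> m a then 1 else 0) \<partial>lborel)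
        * (\<integral>\<^sup>+b. (if 0 \<le> b \<and> ennreal s \<le> n b then 1 else 0) \<partial>lborel) * indicator {0<..t} s \<partial>lborel)"
proof -
  interpret P: pair_sigma_finite M "lborel :: real measure" ..
  obtain \<phi> where [measurable]: "\<phi> \<in> borel_measurable M" and \<phi>1: "\<And>x. \<phi> x \<le> 1"
    and \<phi>t: "(\<integral>\<^sup>+x. \<phi> x \<partial>M) \<le> ennreal t"
    and \<phi>: "\<And>y. 0 \<le> y \<Longrightarrow> min (ennreal t) (emeasure M {x\<in>space M. y < \<bar>F x * G x\<bar>})
      \<le> (\<integral>\<^sup>+x. \<phi> x * indicator {x. y < \<bar>F x * G x\<bar>} x \<partial>M)"
    using layer_weight_exists[of "\<lambda>x. \<bar>F x * G x\<bar>" t] t by auto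
  define A :: "'a \<Rightarrow> real \<Rightarrow> ennreal" where "A x a = (if 0 \<le> a \<and> a < \<bar>F x\<bar> then 1 else 0)" for x a
  define B :: "'a \<Rightarrow> real \<Rightarrow> ennreal" where "B x b = (if 0 \<le> b \<and> b < \<bar>G x\<bar> then 1 else 0)" for x b
  define P :: "real \<Rightarrow> real \<Rightarrow> ennreal" where "P s a = (if 0 \<le> a \<and> ennreal s \<le> m a then 1 else 0)" for s a
  define Q :: "real \<Rightarrow> real \<Rightarrow> ennreal" where "Q s b = (if 0 \<le> b \<and> ennreal s \<le> n b then 1 else 0)" for s b
  have [measurable]: "case_prod A \<in> borel_measurable (M \<Otimes>\<^sub>M borel)" "case_prod B \<in> borel_measurable (M \<Otimes>\<^sub>M borel)"
    "case_prod P \<in> borel_measurable (borel \<Otimes>\<^sub>M borel)" "case_prod Q \<in> borel_measurable (borel \<Otimes>\<^sub>M borel)"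
    unfolding A_def B_def P_def Q_def by measurable
  have intA: "(\<integral>\<^sup>+a. A x a \<partial>lborel) = ennreal \<bar>F x\<bar>" for x
    unfolding A_def by (rule ennreal_eq_nn_integral[symmetric]) simp
  have intB: "(\<integral>\<^sup>+b. B x b \<partial>lborel) = ennreal \<bar>G x\<bar>" for x
    unfolding B_def by (rule ennreal_eq_nn_integral[symmetric]) simp
  \<comment> \<open>The bounds \<open>t\<close>, \<open>m a\<close> and \<open>n b\<close> on the
    weighted mass combine to a minimum, which is the length of the set of \<open>s\<close> in
    \<open>(0, t]\<close> lying below both \<open>m a\<close> and \<open>n b\<close>.\<close>
  have AB: "(\<integral>\<^sup>+x. \<phi> x * A x a * B x b \<partial>M) \<le> (\<integral>\<^sup>+s. P s a * Q s b * indicator {0<..t} s \<partial>lborel)" for a b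
  proof (cases "0 \<le> a \<and> 0 \<le> b")
    case True
    have "(\<integral>\<^sup>+x. \<phi> x * A x a * B x b \<partial>M) \<le> (\<integral>\<^sup>+x. indicator {x\<in>space M. a < \<bar>F x\<bar>} x \<partial>M)"
      using \<phi>1 by (intro nn_integral_mono) (auto simp: A_def B_def indicator_def)
    also have "\<dots> \<le> m a" using m by simp
    finally have 1: "(\<integral>\<^sup>+x. \<phi> x * A x a * B x b \<partial>M) \<le> m a" .
    have "(\<integral>\<^sup>+x. \<phi> x * A x a * B x b \<partial>M) \<le> (\<integral>\<^sup>+x. indicator {x\<in>space M. b < \<bar>G x\<bar>} x \<partial>M)"
      using \<phi>1 by (intro nn_integral_mono) (auto simp: A_def B_def indicator_def)
    also have "\<dots> \<le> n b" using n by simp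
    finally have 2: "(\<integral>\<^sup>+x. \<phi> x * A x a * B x b \<partial>M) \<le> n b" .
    have "(\<integral>\<^sup>+x. \<phi> x * A x a * B x b \<partial>M) \<le> (\<integral>\<^sup>+x. \<phi> x \<partial>M)"
      by (intro nn_integral_mono) (auto simp: A_def B_def)
    then have "(\<integral>\<^sup>+x. \<phi> x * A x a * B x b \<partial>M) \<le> min (ennreal t) (min (m a) (n b))"
      using 1 2 \<phi>t by (auto intro: order_trans)
    also have "\<dots> = (\<integral>\<^sup>+s. P s a * Q s b * indicator {0<..t} s \<partial>lborel)"
      using t True by (subst min_eq_nn_integral) (auto simp: P_def Q_def indicator_def intro!: nn_integral_cong)
    finally show ?thesis .
  next
    case False
    then have "A x a * B x b = 0" for x by (auto simp: A_def B_def)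
    then have "(\<integral>\<^sup>+x. \<phi> x * A x a * B x b \<partial>M) = 0" by (simp only: mult.assoc) simp
    then show ?thesis by simp
  qed
  have "(\<integral>\<^sup>+y. min (ennreal t) (emeasure M {x\<in>space M. y < \<bar>F x * G x\<bar>}) * indicator {0..} y \<partial>lborel)
    \<le> (\<integral>\<^sup>+y. (\<integral>\<^sup>+x. \<phi> x * (if 0 \<le> y \<and> y < \<bar>F x * G x\<bar> then 1 else 0) \<partial>M) \<partial>lborel)"
  proof (intro nn_integral_mono)
    fix y :: real
    have "(\<integral>\<^sup>+x. \<phi> x * indicator {x. y < \<bar>F x * G x\<bar>} x \<partial>M)
      = (\<integral>\<^sup>+x. \<phi> x * (if 0 \<le> y \<and> y < \<bar>F x * G x\<bar> then 1 else 0) \<partial>M)" if "0 \<le> y"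
      using that by (intro nn_integral_cong) (auto simp: indicator_def)
    then show "min (ennreal t) (emeasure M {x\<in>space M. y < \<bar>F x * G x\<bar>}) * indicator {0..} y
      \<le> (\<integral>\<^sup>+x. \<phi> x * (if 0 \<le> y \<and> y < \<bar>F x * G x\<bar> then 1 else 0) \<partial>M)"
      using \<phi>[of y] by (cases "0 \<le> y") auto
  qed
  also have "\<dots> = (\<integral>\<^sup>+x. (\<integral>\<^sup>+y. \<phi> x * (if 0 \<le> y \<and> y < \<bar>F x * G x\<bar> then 1 else 0) \<partial>lborel) \<partial>M)"
    by (rule P.Fubini') measurable
  \<comment> \<open>The layers in \<open>y\<close> add up to \<open>|F G|\<close>, which is then
    sliced anew, first by \<open>|F|\<close> and then by \<open>|G|\<close>.\<close>
  also have "\<dots> = (\<integral>\<^sup>+x. \<phi> x * ennreal \<bar>F x * G x\<bar> \<partial>M)"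
    by (intro nn_integral_cong, subst nn_integral_cmult)
      (simp_all add: ennreal_eq_nn_integral[symmetric])
  also have "\<dots> = (\<integral>\<^sup>+x. (\<integral>\<^sup>+a. \<phi> x * ennreal \<bar>G x\<bar> * A x a \<partial>lborel) \<partial>M)"
    by (intro nn_integral_cong, subst nn_integral_cmult)
      (simp_all add: intA abs_mult ennreal_mult mult_ac)
  also have "\<dots> = (\<integral>\<^sup>+a. (\<integral>\<^sup>+x. \<phi> x * ennreal \<bar>G x\<bar> * A x a \<partial>M) \<partial>lborel)"
    by (rule P.Fubini'[symmetric]) measurable
  also have "\<dots> = (\<integral>\<^sup>+a. (\<integral>\<^sup>+x. (\<integral>\<^sup>+b. \<phi> x * A x a * B x b \<partial>lborel) \<partial>M) \<partial>lborel)"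
    by (intro nn_integral_cong, subst nn_integral_cmult) (simp_all add: intB mult_ac)
  also have "\<dots> = (\<integral>\<^sup>+a. (\<integral>\<^sup>+b. (\<integral>\<^sup>+x. \<phi> x * A x a * B x b \<partial>M) \<partial>lborel) \<partial>lborel)"
    by (intro nn_integral_cong P.Fubini'[symmetric]) measurable
  also have "\<dots> \<le> (\<integral>\<^sup>+a. (\<integral>\<^sup>+b. (\<integral>\<^sup>+s. P s a * Q s b * indicator {0<..t} s \<partial>lborel) \<partial>lborel) \<partial>lborel)"
    by (intro nn_integral_mono AB)
  \<comment> \<open>Moving \<open>s\<close> outermost separates the integrand: for fixed
    \<open>s\<close> the integrals over \<open>a\<close> and \<open>b\<close> form a
    product.\<close>
  also have "\<dots> = (\<integral>\<^sup>+a. (\<integral>\<^sup>+s. (\<integral>\<^sup>+b. P s a * Q s b * indicator {0<..t} s \<partial>lborel) \<partial>lborel) \<partial>lborel)"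
    by (intro nn_integral_cong lborel_pair.Fubini') measurable
  also have "\<dots> = (\<integral>\<^sup>+a. (\<integral>\<^sup>+s. P s a * (\<integral>\<^sup>+b. Q s b \<partial>lborel) * indicator {0<..t} s \<partial>lborel) \<partial>lborel)"
    by (simp add: nn_integral_multc nn_integral_cmult)
  also have "\<dots> = (\<integral>\<^sup>+s. (\<integral>\<^sup>+a. P s a * (\<integral>\<^sup>+b. Q s b \<partial>lborel) * indicator {0<..t} s \<partial>lborel) \<partial>lborel)"
    by (rule lborel_pair.Fubini') measurable
  also have "\<dots> = (\<integral>\<^sup>+s. (\<integral>\<^sup>+a. P s a \<partial>lborel) * (\<integral>\<^sup>+b. Q s b \<partial>lborel) * indicator {0<..t} s \<partial>lborel)"
    by (simp add: nn_integral_multc)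
  finally show ?thesis by (simp add: P_def Q_def)
qed

section \<open>O'Neil's inequality for Lebesgue measure\<close>

lemma nn_integral_rearr_eq:
  assumes f: "f \<in> borel_measurable lebesgue" and t: "0 \<le> t"
  shows "(\<integral>\<^sup>+s. rearr f s * indicator {0<..t} s \<partial>lborel)
    = (\<integral>\<^sup>+y. min (ennreal t) (distrib_fun f y) * indicator {0..} y \<partial>lborel)"
proof -
  have [measurable]: "distrib_fun f \<in> borel_measurable borel"
    using f by (rule borel_measurable_distrib_fun)
  have "(\<integral>\<^sup>+s. rearr f s * indicator {0<..t} s \<partial>lborel)
    = (\<integral>\<^sup>+s. (\<integral>\<^sup>+y. (if 0 \<le> y \<and> ennreal s \<le> distrib_fun f y then 1 else 0) * indicator {0<..t} s \<partial>lborel) \<partial>lborel)"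
    by (subst nn_integral_multc) (auto simp: rearr_eq_nn_integral[OF f])
  also have "\<dots> = (\<integral>\<^sup>+y. (\<integral>\<^sup>+s. (if 0 \<le> y \<and> ennreal s \<le> distrib_fun f y then 1 else 0) * indicator {0<..t} s \<partial>lborel) \<partial>lborel)"
    by (rule lborel_pair.Fubini') measurable
  also have "\<dots> = (\<integral>\<^sup>+y. (\<integral>\<^sup>+s. (if 0 < s \<and> s \<le> t \<and> ennreal s \<le> distrib_fun f y then 1 else 0) * indicator {0..} y \<partial>lborel) \<partial>lborel)"
    by (intro nn_integral_cong) (auto simp: indicator_def)
  also have "\<dots> = (\<integral>\<^sup>+y. min (ennreal t) (distrib_fun f y) * indicator {0..} y \<partial>lborel)"
    using t by (subst nn_integral_multc) (auto simp: min_eq_nn_integral)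
  finally show ?thesis .
qed

text \<open>The layer estimate lives on finite measures, so Lebesgue measure is exhausted by its
  restrictions to balls of radius \<open>n\<close>. With the full distribution functions as
  majorants the bound is the same for every \<open>n\<close> and survives the supremum.\<close>

lemma nn_integral_rearr_mult_le:
  fixes f g :: "'a::euclidean_space \<Rightarrow> real"
  assumes f [measurable]: "f \<in> borel_measurable lebesgue" and g [measurable]: "g \<in> borel_measurable lebesgue"
    and t: "0 < t"
  shows "(\<integral>\<^sup>+s. rearr (\<lambda>x. f x * g x) s * indicator {0<..t} s \<partial>lborel)
    \<le> (\<integral>\<^sup>+s. rearr f s * rearr g s * indicator {0<..t} s \<partial>lborel)"
proof -
  have [measurable]: "distrib_fun f \<in> borel_measurable borel" "distrib_fun g \<in> borel_measurable borel"
    using f g by (auto intro: borel_measurable_distrib_fun)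
  \<comment> \<open>A density, rather than a subspace, keeps the carrier and the sigma-algebra of
    \<open>lebesgue\<close>, so \<open>f\<close> and \<open>g\<close> remain measurable as they
    are.\<close>
  define M where "M n = density lebesgue (indicator (ball (0::'a) (real n)))" for n
  have sM [simp, measurable_cong]: "sets (M n) = sets lebesgue" for n by (simp add: M_def)
  have spM [simp]: "space (M n) = UNIV" for n by (simp add: M_def)
  have eM: "emeasure (M n) X = emeasure lebesgue (X \<inter> ball 0 (real n))" if "X \<in> sets lebesgue" for X n
  proof -
    have "ball (0::'a) (real n) \<in> sets lebesgue" by simp
    then have [measurable]: "(indicator (ball (0::'a) (real n)) :: 'a \<Rightarrow> ennreal) \<in> borel_measurable lebesgue"
      by (rule borel_measurable_indicator)
    have "emeasure (M n) X = (\<integral>\<^sup>+x. indicator (X \<inter> ball 0 (real n)) x \<partial>lebesgue)"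
      unfolding M_def using that
      by (subst emeasure_density) (auto simp: indicator_def intro!: nn_integral_cong)
    also have "\<dots> = emeasure lebesgue (X \<inter> ball 0 (real n))"
      using that by (intro nn_integral_indicator) auto
    finally show ?thesis .
  qed
  have fin: "finite_measure (M n)" for n
  proof (rule finite_measureI)
    have "emeasure (M n) (space (M n)) = emeasure lborel (ball (0::'a) (real n))"
      by (subst eM) auto
    then show "emeasure (M n) (space (M n)) \<noteq> \<infinity>"
      using emeasure_lborel_ball_finite[of "0::'a" "real n"] by simp
  qed
  have leM: "emeasure (M n) {x. y < \<bar>u x\<bar>} \<le> distrib_fun u y"
    if [measurable]: "u \<in> borel_measurable lebesgue" for n y and u :: "'a \<Rightarrow> real"
  proof -
    have "{x \<in> space lebesgue. y < \<bar>u x\<bar>} \<in> sets lebesgue" by measurable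
    then have E: "{x. y < \<bar>u x\<bar>} \<in> sets lebesgue" by simp
    show ?thesis unfolding distrib_fun_def eM[OF E] using E by (intro emeasure_mono) auto
  qed
  \<comment> \<open>Continuity from below in \<open>n\<close>; taking the minimum with
    \<open>t\<close> commutes with suprema.\<close>
  have dist: "min (ennreal t) (distrib_fun (\<lambda>x. f x * g x) y) * indicator {0..} y
    = (SUP n. min (ennreal t) (emeasure (M n) {x. y < \<bar>f x * g x\<bar>}) * indicator {0..} y)" for y
  proof -
    define E where "E = {x \<in> space lebesgue. y < \<bar>f x * g x\<bar>}"
    have E: "E \<in> sets lebesgue" unfolding E_def by measurable
    have "(\<Union>n. E \<inter> ball 0 (real n)) = E"
      using reals_Archimedean2 by auto
    then have "emeasure lebesgue E = (SUP n. emeasure lebesgue (E \<inter> ball 0 (real n)))"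
      using E by (subst SUP_emeasure_incseq) (auto simp: incseq_def)
    then have "distrib_fun (\<lambda>x. f x * g x) y = (SUP n. emeasure (M n) E)"
      using E by (simp add: distrib_fun_def eM E_def)
    then have "min (ennreal t) (distrib_fun (\<lambda>x. f x * g x) y) = (SUP n. min (ennreal t) (emeasure (M n) E))"
      by (simp add: inf_SUP flip: inf_min)
    then show ?thesis by (cases "0 \<le> y") (auto simp: E_def)
  qed
  have "(\<integral>\<^sup>+s. rearr (\<lambda>x. f x * g x) s * indicator {0<..t} s \<partial>lborel)
    = (\<integral>\<^sup>+y. (SUP n. min (ennreal t) (emeasure (M n) {x. y < \<bar>f x * g x\<bar>}) * indicator {0..} y) \<partial>lborel)"
    using t by (subst nn_integral_rearr_eq) (auto simp: dist)
  also have "\<dots> = (SUP n. (\<integral>\<^sup>+y. min (ennreal t) (emeasure (M n) {x. y < \<bar>f x * g x\<bar>}) * indicator {0..} y \<partial>lborel))"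
  proof (rule nn_integral_monotone_convergence_SUP)
    have E: "{x. y < \<bar>f x * g x\<bar>} \<in> sets lebesgue" for y
    proof -
      have "{x \<in> space lebesgue. y < \<bar>f x * g x\<bar>} \<in> sets lebesgue" by measurable
      then show ?thesis by simp
    qed
    show "incseq (\<lambda>n y. min (ennreal t) (emeasure (M n) {x. y < \<bar>f x * g x\<bar>}) * indicator {0..} y)"
      unfolding incseq_def le_fun_def using E
      by (auto simp: eM intro!: mult_right_mono min.mono emeasure_mono)
    fix n
    have "antimono (\<lambda>y. emeasure (M n) {x. y < \<bar>f x * g x\<bar>})"
      using E by (intro antimonoI emeasure_mono) auto
    from borel_measurable_antimono_ennreal[OF this]
    show "(\<lambda>y. min (ennreal t) (emeasure (M n) {x. y < \<bar>f x * g x\<bar>}) * indicator {0..} y) \<in> borel_measurable lborel"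
      by measurable
  qed
  also have "\<dots> \<le> (\<integral>\<^sup>+s. rearr f s * rearr g s * indicator {0<..t} s \<partial>lborel)"
  proof (rule SUP_least)
    fix n
    show "(\<integral>\<^sup>+y. min (ennreal t) (emeasure (M n) {x. y < \<bar>f x * g x\<bar>}) * indicator {0..} y \<partial>lborel)
      \<le> (\<integral>\<^sup>+s. rearr f s * rearr g s * indicator {0<..t} s \<partial>lborel)"
      using finite_measure.nn_integral_min_layer_product_le[OF fin, of f n g "distrib_fun f" "distrib_fun g" t] leM t
      by (simp add: rearr_eq_nn_integral)
  qed
  finally show ?thesis .
qed

section \<open>Combination of the O'Neil, Hardy, embedding and Hoelder inequalities\<close>

theorem theorem2p6:
  fixes f g :: "'a::euclidean_space \<Rightarrow> real"
    and p p1 p2 :: real and q q1 q2 :: ennreal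
  assumes "p > 1" and "1 \<le> q"
    and "1 \<le> p1" and "1 \<le> p2"
    and "0 < q1" and "0 < q2"
    and "1 / p1 + 1 / p2 = 1 / p"
    and "inverse q1 + inverse q2 \<ge> inverse q"
    and "f \<in> borel_measurable lebesgue" and "g \<in> borel_measurable lebesgue"
    and "lorentz_qnorm p1 q1 f < \<infinity>" and "lorentz_qnorm p2 q2 g < \<infinity>"
  shows "lorentz_norm p q (\<lambda>x. f x * g x)
           \<le> ennreal (exp (1 / exp 1) * (p / (p - 1))) * lorentz_qnorm p1 q1 f * lorentz_qnorm p2 q2 g"
proof -
  define h where "h s = rearr f s * rearr g s" for s
  \<comment> \<open>With \<open>inverse top = 0\<close> infinite exponents are covered; if both are
    infinite, \<open>r = top\<close>.\<close>
  define r where "r = inverse (inverse q1 + inverse q2)"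
  have h: "antimono h"
    using rearr_antimono[of f] rearr_antimono[of g] by (auto simp: h_def antimono_def intro!: mult_mono)
  have r: "0 < r" "r \<le> q"
  proof -
    show "0 < r" using assms(5,6) by (auto simp: r_def ennreal_inverse_positive)
    have "r \<le> inverse (inverse q)"
      unfolding r_def using assms(8) by (rule ennreal_inverse_antimono)
    then show "r \<le> q" by (simp add: ennreal_inverse_inverse)
  qed
  have "lorentz_norm p q (\<lambda>x. f x * g x)
    \<le> scale_norm q (\<lambda>t. ennreal (t powr (1 / p)) * (ennreal (1 / t) * (\<integral>\<^sup>+s. h s * indicator {0<..t} s \<partial>lborel)))"
    unfolding lorentz_norm_eq_scale_norm maxrearr_def h_def
    using assms by (intro scale_norm_mono mult_left_mono nn_integral_rearr_mult_le) auto
  \<comment> \<open>Hardy's inequality is applied at \<open>q >= 1\<close>, before the exponent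
    drops to \<open>r\<close>, which may be less than 1.\<close>
  also have "\<dots> \<le> ennreal (p / (p - 1)) * scale_norm q (\<lambda>t. ennreal (t powr (1 / p)) * h t)"
    using assms h by (intro scale_norm_Hardy borel_measurable_antimono_ennreal)
  also have "\<dots> \<le> ennreal (p / (p - 1)) *
      (ennreal (exp (1 / exp 1)) * scale_norm r (\<lambda>t. ennreal (t powr (1 / p)) * h t))"
    using assms h r by (intro mult_left_mono scale_norm_embedding) auto
  \<comment> \<open>The relation between \<open>p\<close>, \<open>p1\<close> and \<open>p2\<close>
    splits the power of \<open>t\<close> between the two rearrangements.\<close>
  also have "(\<lambda>t. ennreal (t powr (1 / p)) * h t) =
    (\<lambda>t. (ennreal (t powr (1 / p1)) * rearr f t) * (ennreal (t powr (1 / p2)) * rearr g t))"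
    unfolding assms(7)[symmetric] by (simp add: h_def powr_add ennreal_mult mult_ac)
  also have "ennreal (p / (p - 1)) * (ennreal (exp (1 / exp 1)) * scale_norm r \<dots>)
    \<le> ennreal (p / (p - 1)) * (ennreal (exp (1 / exp 1)) * (lorentz_qnorm p1 q1 f * lorentz_qnorm p2 q2 g))"
    unfolding r_def lorentz_qnorm_eq_scale_norm
    using assms by (intro mult_left_mono scale_norm_Holder) auto
  also have "\<dots> = ennreal (exp (1 / exp 1) * (p / (p - 1))) * lorentz_qnorm p1 q1 f * lorentz_qnorm p2 q2 g"
    using assms(1) by (subst ennreal_mult) (auto simp: mult_ac)
  finally show ?thesis .
qed

end
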